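(* Let $n$ be an integer with $1<n<\omega$ and let $\kappa\geq\omega$ be a cardinal. Then there is an $n$-resolvable Tychonoff space $(X,\mathcal{T})$ such that $|X|=\kappa$ and $(X,\mathcal{T})$ admits no exactly $n$-resolvable quasi-regular expansion; that is, there is no topology $\mathcal{U}\supseteq\mathcal{T}$ on $X$ such that $(X,\mathcal{U})$ is both exactly $n$-resolvable and quasi-regular.
   Context: For a (possibly finite) cardinal $\lambda>1$, a space is $\lambda$-resolvable if there is a family of $\lambda$-many pairwise disjoint nonempty subsets, each dense in the space. For finite $n>1$, a space is exactly $n$-resolvable if it is $n$-resolvable but not $(n+1)$-resolvable. An expansion of a topology $\mathcal{T}$ on a set $X$ is a topology $\mathcal{U}$ on $X$ with $\mathcal{U}\supseteq\mathcal{T}$. A space $(X,\mathcal{T})$ is quasi-regular if for every nonempty $U\in\mathcal{T}$ there is a nonempty $V\in\mathcal{T}$ whose closure in $(X,\mathcal{T})$ is contained in $U$. *)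

theory Defs
  imports "HOL-Analysis.Analysis"
begin

unbundle cardinal_syntax

(* lambda-resolvability for finite lambda = n; only meant for n > 1. *)
definition n_resolvable :: "nat \<Rightarrow> 'a topology \<Rightarrow> bool" where
  "n_resolvable n X \<longleftrightarrow>
     (\<exists>\<D>. finite \<D> \<and> card \<D> = n \<and> pairwise disjnt \<D> \<and>
          (\<forall>D\<in>\<D>. D \<subseteq> topspace X \<and> D \<noteq> {} \<and> X closure_of D = topspace X))"

definition exactly_n_resolvable :: "nat \<Rightarrow> 'a topology \<Rightarrow> bool" where
  "exactly_n_resolvable n X \<longleftrightarrow> n_resolvable n X \<and> \<not> n_resolvable (n + 1) X"

definition expansion :: "'a topology \<Rightarrow> 'a topology \<Rightarrow> bool" where
  "expansion U T \<longleftrightarrow> topspace U = topspace T \<and> (\<forall>S. openin T S \<longrightarrow> openin U S)"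

definition quasi_regular_space :: "'a topology \<Rightarrow> bool" where
  "quasi_regular_space X \<longleftrightarrow>
     (\<forall>U. openin X U \<and> U \<noteq> {} \<longrightarrow>
          (\<exists>V. openin X V \<and> V \<noteq> {} \<and> X closure_of V \<subseteq> U))"

(* Tychonoff is taken to include the Hausdorff axiom, which the library's
   completely_regular_space does not. *)
definition tychonoff_space :: "'a topology \<Rightarrow> bool" where
  "tychonoff_space X \<longleftrightarrow> completely_regular_space X \<and> Hausdorff_space X"

end

theory Submission
  imports Defs
begin

text \<open>
  Suppose \<open>X\<close> is a disjoint union of \<open>n + 1\<close> dense pieces \<open>D i\<close> such that every nonempty crowded
  subset of a piece contains the trace of a nonempty open set on that piece. In an \<open>n\<close>-resolvable
  expansion \<open>U\<close> every nonempty open set meets at least \<open>n\<close> pieces, because two disjoint sets dense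
  in the same \<open>U\<close>-open set cannot both be carried by one piece. If \<open>U\<close> is not
  \<open>(n + 1)\<close>-resolvable, some \<open>D j\<close> is not \<open>U\<close>-dense, and quasi-regularity gives a nonempty
  \<open>U\<close>-open \<open>V\<close> whose closure misses \<open>D j\<close>. On all other pieces \<open>V\<close> contains the trace of one
  original open set \<open>G\<close>, so \<open>G\<close> minus the closure of \<open>V\<close> is a nonempty \<open>U\<close>-open subset of the
  single piece \<open>D j\<close>, a contradiction.

  Such a space is generated by clopen sets \<open>g (P, Q)\<close>, one for each pair \<open>P \<subseteq> Q \<subseteq> X\<close>, all of
  whose finite Boolean combinations meet every piece. One starts with such a family and, by Zorn's
  lemma, changes \<open>g (P, Q)\<close> on \<open>Q\<close> to \<open>P\<close> for as many pairs as possible. In the result every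
  nowhere dense set is discrete, and no subset of a piece is both dense and codense in the trace of
  a nonempty open set.
\<close>

section \<open>Expansions of unions of dense pieces\<close>

lemma n_resolvable_no_isolated:
  assumes "n_resolvable n U" "1 < n"
  shows "\<not> openin U {x}"
proof
  assume x: "openin U {x}"
  obtain \<D> where D: "card \<D> = n" "pairwise disjnt \<D>" "\<forall>D\<in>\<D>. U closure_of D = topspace U"
    using assms(1) unfolding n_resolvable_def by blast
  have "finite \<D>" "\<not> card \<D> \<le> Suc 0" using D(1) assms(2) card.infinite by fastforce+
  then obtain A B where AB: "A \<in> \<D>" "B \<in> \<D>" "A \<noteq> B"
    using card_le_Suc0_iff_eq by blast
  have "x \<in> C" if "C \<in> \<D>" for C
  proof -
    have "C \<inter> {x} \<noteq> {}"
      using D(3) that x dense_intersects_open[of U C] by blast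
    then show ?thesis by blast
  qed
  then show False
    using AB pairwiseD[OF D(2) AB] unfolding disjnt_def by blast
qed

text \<open>Without isolated points, deleting a point from an open subset of \<open>W\<close> leaves
  a nonempty set, open by T1, which \<open>C\<close> still meets. This makes dense parts crowded, as
  \<open>thick\<close> requires.\<close>

lemma crowded_Int_open:
  assumes "t1_space U" "\<And>x. \<not> openin U {x}" "openin U W" "W \<subseteq> U closure_of C"
  shows "C \<inter> W \<subseteq> U derived_set_of (C \<inter> W)"
proof
  fix x assume x: "x \<in> C \<inter> W"
  show "x \<in> U derived_set_of (C \<inter> W)"
    unfolding in_derived_set_of
  proof (intro conjI allI impI)
    show "x \<in> topspace U" using x assms(3) openin_subset by blast
    fix N assume N: "x \<in> N \<and> openin U N"
    have o: "openin U (N \<inter> W - {x})"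
      using assms(1,3) N by (simp add: openin_Int t1_space_openin_delete_alt)
    have "N \<inter> W \<noteq> {x}"
      using assms(2)[of x] N assms(3) by (metis openin_Int)
    then obtain z where z: "z \<in> N \<inter> W - {x}" using x N by blast
    then have "z \<in> U closure_of C" using assms(4) by blast
    then obtain y where "y \<in> C" "y \<in> N \<inter> W - {x}"
      using o z unfolding in_closure_of by meson
    then show "\<exists>y\<noteq>x. y \<in> C \<inter> W \<and> y \<in> N" by blast
  qed
qed

text \<open>Both alternatives survive further shrinking, so the members of \<open>\<F>\<close> can
  be treated in turn: if \<open>F\<close> is not dense in the current set, removing its closure
  leaves a nonempty open set missing \<open>F\<close>.\<close>

lemma open_shrink_dense_or_disjoint:
  assumes "finite \<F>" "openin U W" "W \<noteq> {}"
  obtains W' where "openin U W'" "W' \<noteq> {}" "W' \<subseteq> W"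
    "\<And>F. F \<in> \<F> \<Longrightarrow> W' \<inter> F = {} \<or> W' \<subseteq> U closure_of F"
proof -
  have "\<exists>W'. openin U W' \<and> W' \<noteq> {} \<and> W' \<subseteq> W \<and> (\<forall>F\<in>\<F>. W' \<inter> F = {} \<or> W' \<subseteq> U closure_of F)"
    using assms
  proof (induction \<F>)
    case empty
    then show ?case by blast
  next
    case (insert F \<F>)
    then obtain W' where W': "openin U W'" "W' \<noteq> {}" "W' \<subseteq> W"
      "\<forall>F\<in>\<F>. W' \<inter> F = {} \<or> W' \<subseteq> U closure_of F" by blast
    show ?case
    proof (cases "W' \<subseteq> U closure_of F")
      case True
      then show ?thesis using W' by blast
    next
      case False
      have "openin U (W' - U closure_of F)" using W'(1) by (simp add: openin_diff)
      moreover have "(W' - U closure_of F) \<inter> F = {}"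
        using openin_subset[OF W'(1)] by (auto simp: in_closure_of)
      ultimately show ?thesis
        using W' False by (intro exI[of _ "W' - U closure_of F"]) blast
    qed
  qed
  then show ?thesis using that by blast
qed

text \<open>A finer topology has fewer limit points, so sets crowded in \<open>U\<close> are crowded
  in \<open>T\<close>, where \<open>thick\<close> applies.\<close>

lemma expansion_derived_set_subset:
  assumes "expansion U T"
  shows "U derived_set_of A \<subseteq> T derived_set_of A"
proof
  fix x assume "x \<in> U derived_set_of A"
  moreover have "topspace U = topspace T" "\<And>S. openin T S \<Longrightarrow> openin U S"
    using assms unfolding expansion_def by auto
  ultimately show "x \<in> T derived_set_of A"
    unfolding in_derived_set_of by metis
qed

lemma expansion_t1_space:
  assumes "expansion U T" "t1_space T"
  shows "t1_space U"
  by (rule t1_space_expansive[OF _ _ assms(2)]) (use assms(1) in \<open>auto simp: expansion_def\<close>)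

text \<open>Each of the \<open>n\<close> dense sets is dense, within a small open set, on some
  single piece. Two of them cannot share a piece: by \<open>thick\<close>, the first would fill the
  trace of an open set there and leave no room for the second.\<close>

lemma card_pieces_of_open:
  assumes "1 < n" "n_resolvable n U" "expansion U T" "t1_space T"
    and thick: "\<And>i A. \<lbrakk>i \<in> I; A \<subseteq> D i; A \<noteq> {}; A \<subseteq> T derived_set_of A\<rbrakk>
           \<Longrightarrow> \<exists>G. openin T G \<and> G \<inter> D i \<noteq> {} \<and> G \<inter> D i \<subseteq> A"
    and "finite I" "openin U W" "W \<noteq> {}" "W \<subseteq> (\<Union>i\<in>I. D i)"
  shows "n \<le> card I"
proof -
  obtain \<C> where C: "finite \<C>" "card \<C> = n" "pairwise disjnt \<C>"
      "\<forall>C\<in>\<C>. U closure_of C = topspace U"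
    using assms(2) unfolding n_resolvable_def by blast
  note iso = n_resolvable_no_isolated[OF assms(2,1)]
  note t1 = expansion_t1_space[OF assms(3,4)]
  have "finite ((\<lambda>(C,i). C \<inter> D i) ` (\<C> \<times> I))" using C(1) assms(6) by blast
  from open_shrink_dense_or_disjoint[OF this assms(7,8)]
  obtain W' where W': "openin U W'" "W' \<noteq> {}" "W' \<subseteq> W"
    "\<And>F. F \<in> (\<lambda>(C,i). C \<inter> D i) ` (\<C> \<times> I) \<Longrightarrow> W' \<inter> F = {} \<or> W' \<subseteq> U closure_of F" by blast
  have dd: "W' \<inter> (C \<inter> D i) = {} \<or> W' \<subseteq> U closure_of (C \<inter> D i)" if "C \<in> \<C>" "i \<in> I" for C i
    using W'(4) that by blast
  have "\<exists>i\<in>I. W' \<subseteq> U closure_of (C \<inter> D i)" if c: "C \<in> \<C>" for C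
  proof -
    have "C \<inter> W' \<noteq> {}" using C(4) c W'(1,2) dense_intersects_open by metis
    then show ?thesis using dd[OF c] W'(3) assms(9) by blast
  qed
  then obtain f where f: "\<And>C. C \<in> \<C> \<Longrightarrow> f C \<in> I \<and> W' \<subseteq> U closure_of (C \<inter> D (f C))" by metis
  have "inj_on f \<C>"
  proof (rule inj_onI, rule ccontr)
    fix B C assume BC: "B \<in> \<C>" "C \<in> \<C>" "f B = f C" "B \<noteq> C"
    define i where "i = f C"
    have iI: "i \<in> I" and B: "W' \<subseteq> U closure_of (B \<inter> D i)" and CC: "W' \<subseteq> U closure_of (C \<inter> D i)"
      using f BC unfolding i_def by metis+
    have ne: "B \<inter> D i \<inter> W'' \<noteq> {} \<and> C \<inter> D i \<inter> W'' \<noteq> {}"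
      if "openin U W''" "W'' \<noteq> {}" "W'' \<subseteq> W'" for W''
      using that B CC unfolding in_closure_of subset_iff by (metis IntI empty_iff ex_in_conv)
    have "B \<inter> D i \<inter> W' \<subseteq> T derived_set_of (B \<inter> D i \<inter> W')"
      using crowded_Int_open[OF t1 iso W'(1) B] expansion_derived_set_subset[OF assms(3)] by fastforce
    then obtain G where G: "openin T G" "G \<inter> D i \<noteq> {}" "G \<inter> D i \<subseteq> B \<inter> D i \<inter> W'"
      using thick[OF iI, of "B \<inter> D i \<inter> W'"] ne[OF W'(1,2)] by blast
    \<comment> \<open>Density of \<open>C \<inter> D i\<close> in \<open>W'\<close> puts a point of
      \<open>C\<close> into \<open>G \<inter> D i\<close>, which lies in \<open>B\<close>.\<close>
    have "openin U (G \<inter> W')" "G \<inter> W' \<noteq> {}"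
      using G assms(3) W'(1) unfolding expansion_def by blast+
    then obtain x where "x \<in> C \<inter> D i \<inter> (G \<inter> W')" using ne by blast
    then have "x \<in> B \<inter> C" using G(3) by blast
    then show False using BC C(3) by (metis disjnt_def empty_iff pairwiseD)
  qed
  moreover have "f ` \<C> \<subseteq> I" using f by blast
  ultimately show ?thesis using C(2) assms(6) by (metis card_inj_on_le)
qed

lemma no_exactly_n_resolvable_expansion:
  assumes n: "1 < n" and T: "t1_space T" and cover: "topspace T = (\<Union>i\<le>n. D i)"
    and disj: "disjoint_family_on D {..n}"
    and dense: "\<And>i. i \<le> n \<Longrightarrow> T closure_of D i = topspace T"
    and ne: "topspace T \<noteq> {}"
    and thick: "\<And>i A. \<lbrakk>i \<le> n; A \<subseteq> D i; A \<noteq> {}; A \<subseteq> T derived_set_of A\<rbrakk>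
           \<Longrightarrow> \<exists>G. openin T G \<and> G \<inter> D i \<noteq> {} \<and> G \<inter> D i \<subseteq> A"
    and U: "expansion U T" "quasi_regular_space U"
  shows "\<not> exactly_n_resolvable n U"
proof
  assume ex: "exactly_n_resolvable n U"
  then have res: "n_resolvable n U" and nres: "\<not> n_resolvable (n + 1) U"
    unfolding exactly_n_resolvable_def by auto
  have top: "topspace U = topspace T" and UT: "\<And>S. openin T S \<Longrightarrow> openin U S"
    using U(1) unfolding expansion_def by auto
  note iso = n_resolvable_no_isolated[OF res n]
  note t1 = expansion_t1_space[OF U(1) T]
  have pieces: "n \<le> card I" if "I \<subseteq> {..n}" "openin U W" "W \<noteq> {}" "W \<subseteq> (\<Union>i\<in>I. D i)" for I W
  proof (rule card_pieces_of_open[OF n res U(1) T _ _ that(2-4)])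
    show "finite I" using that(1) finite_subset by blast
  next
    fix i A assume "i \<in> I" "A \<subseteq> D i" "A \<noteq> {}" "A \<subseteq> T derived_set_of A"
    then show "\<exists>G. openin T G \<and> G \<inter> D i \<noteq> {} \<and> G \<inter> D i \<subseteq> A"
      using thick that(1) by (metis atMost_iff subsetD)
  qed
  \<comment> \<open>Otherwise the \<open>n + 1\<close> pieces themselves would witness
    \<open>(n + 1)\<close>-resolvability of \<open>U\<close>.\<close>
  have "\<exists>j\<le>n. U closure_of D j \<noteq> topspace U"
  proof (rule ccontr)
    assume "\<not> ?thesis"
    then have d: "U closure_of D j = topspace U" if "j \<le> n" for j using that by blast
    have Dne: "D j \<noteq> {}" if "j \<le> n" for j using d[OF that] ne top by force
    have inj: "inj_on D {..n}"
      using Dne disj unfolding inj_on_def disjoint_family_on_def by (metis Int_absorb atMost_iff)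
    have "pairwise disjnt (D ` {..n})"
      using disj disjoint_family_on_disjoint_image by blast
    then have "n_resolvable (n + 1) U"
      unfolding n_resolvable_def using inj d Dne top cover
      by (intro exI[of _ "D ` {..n}"]) (simp add: card_image UN_upper)
    then show False using nres by blast
  qed
  then obtain j where j: "j \<le> n" "U closure_of D j \<noteq> topspace U" by blast
  define W where "W = topspace U - U closure_of D j"
  have W: "openin U W" "W \<noteq> {}"
    using j(2) closure_of_subset_topspace[of U "D j"] unfolding W_def by (auto simp: openin_diff)
  have "D j \<subseteq> U closure_of D j"
    by (rule closure_of_subset) (use top cover j in blast)
  then have WD: "W \<inter> D j = {}" unfolding W_def by blast
  obtain V where V: "openin U V" "V \<noteq> {}" "U closure_of V \<subseteq> W"
    using U(2) W unfolding quasi_regular_space_def by blast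
  have VW: "V \<subseteq> W" using V closure_of_subset openin_subset by (metis subset_trans)
  \<comment> \<open>Pieces are absorbed one at a time. The set \<open>G\<close> must be open in
    \<open>T\<close>, not just in \<open>U\<close>, so that the \<open>T\<close>-dense piece
    \<open>D j\<close> is certain to meet it.\<close>
  have "\<exists>G. openin T G \<and> G \<inter> V \<noteq> {} \<and> (\<forall>i\<in>I. G \<inter> D i \<subseteq> V)"
    if "finite I" "I \<subseteq> {..n} - {j}" for I
    using that
  proof (induction I)
    case empty
    have "topspace T \<inter> V \<noteq> {}" using V openin_subset top by blast
    then show ?case by blast
  next
    case (insert i I)
    then obtain G where G: "openin T G" "G \<inter> V \<noteq> {}" "\<forall>i\<in>I. G \<inter> D i \<subseteq> V" by blast
    have GV: "openin U (G \<inter> V)" using G UT V by blast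
    have i: "i \<le> n" "i \<noteq> j" using insert by auto
    \<comment> \<open>A nonempty open subset of \<open>W\<close> already misses \<open>D j\<close>;
      if it also missed \<open>D i\<close>, only \<open>n - 1\<close> pieces would cover it, against
      \<open>pieces\<close>.\<close>
    have GVD: "D i \<inter> W' \<noteq> {}" if W': "openin U W'" "W' \<noteq> {}" "W' \<subseteq> W" for W'
    proof
      assume "D i \<inter> W' = {}"
      have "W' \<subseteq> (\<Union>k\<in>{..n} - {i,j}. D k)"
      proof
        fix x assume x: "x \<in> W'"
        then obtain k where "k \<le> n" "x \<in> D k"
          using openin_subset[OF W'(1)] top cover by auto
        moreover from this have "k \<noteq> i" "k \<noteq> j"
          using x W'(3) WD \<open>D i \<inter> W' = {}\<close> by blast+
        ultimately show "x \<in> (\<Union>k\<in>{..n} - {i,j}. D k)" by blast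
      qed
      then have "n \<le> card ({..n} - {i,j})" using W' by (intro pieces[of _ W']) auto
      moreover have "card ({..n} - {i,j}) = n - 1" using i j by (simp add: card_Diff_subset)
      ultimately show False using n by simp
    qed
    have "G \<inter> V \<subseteq> U closure_of D i"
    proof
      fix x assume x: "x \<in> G \<inter> V"
      show "x \<in> U closure_of D i"
        unfolding in_closure_of
      proof (intro conjI allI impI)
        show "x \<in> topspace U" using x openin_subset[OF V(1)] by blast
        fix N assume "x \<in> N \<and> openin U N"
        then have "D i \<inter> (N \<inter> (G \<inter> V)) \<noteq> {}"
          using GVD[of "N \<inter> (G \<inter> V)"] GV x VW by blast
        then show "\<exists>y. y \<in> D i \<and> y \<in> N" by blast
      qed
    qed
    from crowded_Int_open[OF t1 iso GV this]
    have "D i \<inter> (G \<inter> V) \<subseteq> T derived_set_of (D i \<inter> (G \<inter> V))"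
      using expansion_derived_set_subset[OF U(1)] by blast
    moreover have "D i \<inter> (G \<inter> V) \<noteq> {}" using GVD[OF GV G(2)] VW by blast
    ultimately obtain H where H: "openin T H" "H \<inter> D i \<noteq> {}" "H \<inter> D i \<subseteq> D i \<inter> (G \<inter> V)"
      using thick[OF i(1), of "D i \<inter> (G \<inter> V)"] by blast
    then show ?case using G by (intro exI[of _ "G \<inter> H"]) blast
  qed
  from this[of "{..n} - {j}"] obtain G where G: "openin T G" "G \<inter> V \<noteq> {}"
      "\<forall>i\<in>{..n}-{j}. G \<inter> D i \<subseteq> V" by blast
  have VS: "V \<subseteq> U closure_of V" using V(1) by (simp add: closure_of_subset openin_subset)
  \<comment> \<open>On every piece except \<open>D j\<close>, \<open>G\<close> lies in
    \<open>V\<close>. What remains is nonempty because \<open>D j\<close> meets \<open>G\<close> and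
    misses the closure of \<open>V\<close>.\<close>
  have "G - U closure_of V \<subseteq> (\<Union>i\<in>{j}. D i)"
  proof
    fix x assume x: "x \<in> G - U closure_of V"
    then obtain i where "i \<le> n" "x \<in> D i" using openin_subset[OF G(1)] cover by auto
    moreover from this have "i = j" using x G(3) VS by blast
    ultimately show "x \<in> (\<Union>i\<in>{j}. D i)" by simp
  qed
  moreover have "openin U (G - U closure_of V)" using UT[OF G(1)] by (simp add: openin_diff)
  moreover have "G - U closure_of V \<noteq> {}"
  proof -
    have "D j \<inter> G \<noteq> {}" using dense[OF j(1)] G(1,2) dense_intersects_open[of T "D j"] by blast
    then show ?thesis using V(3) WD by blast
  qed
  ultimately have "n \<le> card {j}" by (intro pieces[of _ "G - U closure_of V"]) (use j(1) in simp_all)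
  then show False using n by simp
qed

section \<open>Saturated independent families\<close>

lemma card_of_Times_ordLeq_infinite:
  assumes "infinite C" "|A| \<le>o |C|" "|B| \<le>o |C|"
  shows "|A \<times> B| \<le>o |C|"
  by (rule card_of_Sigma_ordLeq_infinite[OF assms(1,2)]) (simp add: assms(3))

text \<open>The finite subsets split by size into countably many layers. Each layer is an image of
  the product of \<open>A\<close> with the previous one.\<close>

lemma card_of_Fpow_ordLeq_infinite:
  assumes "infinite A"
  shows "|Fpow A| \<le>o |A|"
proof -
  define S where "S k = {B. B \<subseteq> A \<and> finite B \<and> card B = k}" for k
  have S: "|S k| \<le>o |A|" for k
  proof (induction k)
    case 0
    have "S 0 = {{}}" unfolding S_def by auto
    then show ?case using assms by (metis card_of_singl_ordLeq infinite_imp_nonempty)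
  next
    case (Suc k)
    have "S (Suc k) \<subseteq> (\<lambda>(a,B). insert a B) ` (A \<times> S k)"
    proof
      fix B assume B: "B \<in> S (Suc k)"
      then obtain a where a: "a \<in> B" unfolding S_def by fastforce
      then have "(a, B - {a}) \<in> A \<times> S k" "B = insert a (B - {a})"
        using B unfolding S_def by auto
      then show "B \<in> (\<lambda>(a,B). insert a B) ` (A \<times> S k)" by (metis case_prod_conv image_eqI)
    qed
    then have "|S (Suc k)| \<le>o |A \<times> S k|" by (metis surj_imp_ordLeq)
    also have "|A \<times> S k| \<le>o |A|" 
      by (rule card_of_Times_ordLeq_infinite[OF assms ordLeq_refl[OF card_of_Card_order] Suc])
    finally (ordLeq_transitive) show ?case .
  qed
  have "Fpow A = (\<Union>k\<in>UNIV. S k)" unfolding Fpow_def S_def by auto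
  moreover have "|UNIV :: nat set| \<le>o |A|" using assms infinite_iff_card_of_nat by blast
  ultimately show ?thesis using card_of_UNION_ordLeq_infinite[OF assms, of UNIV S] S by simp
qed

text \<open>The function \<open>s\<close> prescribes a membership pattern, and only its values on
  \<open>F\<close> matter. Requiring a witness in every \<open>D j\<close> is what later makes every
  piece dense.\<close>

definition independent_on :: "'i set \<Rightarrow> 'j set \<Rightarrow> ('j \<Rightarrow> 'a set) \<Rightarrow> ('i \<Rightarrow> 'a set) \<Rightarrow> bool" where
  "independent_on L J D g \<longleftrightarrow>
     (\<forall>F s j. finite F \<and> F \<subseteq> L \<and> j \<in> J \<longrightarrow> (\<exists>y\<in>D j. \<forall>\<xi>\<in>F. y \<in> g \<xi> \<longleftrightarrow> s \<xi>))"

text \<open>A pair \<open>(P, Q)\<close> is read as the wish that a member of the family cut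
  \<open>Q\<close> in exactly \<open>P\<close>. Using the wishes as indices reserves one member for
  each.\<close>

definition traces :: "'a set \<Rightarrow> ('a set \<times> 'a set) set" where
  "traces X = {(P, Q). P \<subseteq> Q \<and> Q \<subseteq> X}"

lemma traces_subset:
  assumes "\<xi> \<in> traces X"
  shows "fst \<xi> \<subseteq> X" "snd \<xi> \<subseteq> X"
  using assms unfolding traces_def by auto

text \<open>The Fichtenholz--Kantorovich construction: a point codes a finite set \<open>E\<close> together with a finite
  set \<open>S\<close> of pairs of subsets of \<open>E\<close>, plus the index of a piece.\<close>

lemma ex_independent_on_traces:
  fixes X :: "'a set" and n :: nat
  assumes X: "infinite X"
  obtains D f where "X = (\<Union>i\<le>n. D i)" "disjoint_family_on D {..n}"
    "independent_on (traces X) {..n} D f"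
proof -
  let ?M = "Fpow X \<times> Fpow (Fpow X \<times> Fpow X) \<times> {..n}"
  note times = card_of_Times_ordLeq_infinite[OF X]
  have 1: "|Fpow X| \<le>o |X|" by (rule card_of_Fpow_ordLeq_infinite[OF X])
  have 2: "|Fpow X \<times> Fpow X| \<le>o |X|" using times[OF 1 1] .
  have inf: "infinite (Fpow X \<times> Fpow X)"
  proof -
    have "(\<lambda>x. ({x}, {x})) ` X \<subseteq> Fpow X \<times> Fpow X" by (auto simp: Fpow_def)
    moreover have "infinite ((\<lambda>x. ({x}, {x})) ` X)" 
      using X by (subst finite_image_iff) (auto simp: inj_on_def)
    ultimately show ?thesis using finite_subset by blast
  qed
  have 3: "|Fpow (Fpow X \<times> Fpow X)| \<le>o |X|"
    by (rule ordLeq_transitive[OF card_of_Fpow_ordLeq_infinite[OF inf] 2])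
  have 4: "|{..n}| \<le>o |X|"
    by (intro ordLess_imp_ordLeq finite_ordLess_infinite card_of_Well_order) (simp_all add: Field_card_of X)
  have "|?M| \<le>o |X|" using times[OF 1 times[OF 3 4]] .
  moreover have "?M \<noteq> {}" by (simp add: Fpow_not_empty Times_empty)
  \<comment> \<open>Surjectivity is enough: every code is attained, and a point may be assigned any
    code.\<close>
  ultimately obtain h where h: "h ` X = ?M" using card_of_ordLeq2[of ?M X] by blast
  define f where "f = (\<lambda>(P, Q). {x. case h x of (E, S, i) \<Rightarrow> (P \<inter> E, Q \<inter> E) \<in> S})"
  define D where "D i = {x \<in> X. snd (snd (h x)) = i}" for i
  have "X = (\<Union>i\<le>n. D i)"
  proof
    show "X \<subseteq> (\<Union>i\<le>n. D i)"
    proof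
      fix x assume "x \<in> X"
      moreover from this have "h x \<in> ?M" using h by blast
      ultimately show "x \<in> (\<Union>i\<le>n. D i)" unfolding D_def by (cases "h x") auto
    qed
  qed (auto simp: D_def)
  moreover have "disjoint_family_on D {..n}"
    unfolding D_def disjoint_family_on_def by auto
  moreover have "independent_on (traces X) {..n} D f"
    unfolding independent_on_def
  proof (intro allI impI)
    fix F s i assume F: "finite F \<and> F \<subseteq> traces X \<and> i \<in> {..n}"
    \<comment> \<open>Finitely many distinct pairs are told apart by finitely many points.
      Collecting these points in \<open>E\<close> makes \<open>tr\<close> injective on
      \<open>F\<close>, so \<open>S\<close> can accept exactly the pairs with
      \<open>s \<xi>\<close>.\<close>
    have "\<exists>e\<in>X. (e \<in> fst \<xi> \<longleftrightarrow> e \<notin> fst \<zeta>) \<or> (e \<in> snd \<xi> \<longleftrightarrow> e \<notin> snd \<zeta>)"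
      if "\<xi> \<in> F" "\<zeta> \<in> F" "\<xi> \<noteq> \<zeta>" for \<xi> \<zeta>
    proof -
      have sub: "fst \<xi> \<subseteq> X" "fst \<zeta> \<subseteq> X" "snd \<xi> \<subseteq> X" "snd \<zeta> \<subseteq> X"
        using that F traces_subset by blast+
      have "fst \<xi> \<noteq> fst \<zeta> \<or> snd \<xi> \<noteq> snd \<zeta>" using that(3) prod_eq_iff by blast
      then show ?thesis using sub by blast
    qed
    then obtain e where e: "\<And>\<xi> \<zeta>. \<lbrakk>\<xi> \<in> F; \<zeta> \<in> F; \<xi> \<noteq> \<zeta>\<rbrakk> \<Longrightarrow> e \<xi> \<zeta> \<in> X \<and>
        ((e \<xi> \<zeta> \<in> fst \<xi> \<longleftrightarrow> e \<xi> \<zeta> \<notin> fst \<zeta>) \<or> (e \<xi> \<zeta> \<in> snd \<xi> \<longleftrightarrow> e \<xi> \<zeta> \<notin> snd \<zeta>))"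
      by metis
    define E where "E = X \<inter> (\<lambda>(\<xi>, \<zeta>). e \<xi> \<zeta>) ` (F \<times> F)"
    define tr where "tr \<xi> = (fst \<xi> \<inter> E, snd \<xi> \<inter> E)" for \<xi> :: "'a set \<times> 'a set"
    have E: "finite E" "E \<subseteq> X" using F unfolding E_def by auto
    have eE: "e \<xi> \<zeta> \<in> E" if "\<xi> \<in> F" "\<zeta> \<in> F" "\<xi> \<noteq> \<zeta>" for \<xi> \<zeta>
      using e[OF that] that unfolding E_def by force
    have inj: "\<xi> = \<zeta>" if "\<xi> \<in> F" "\<zeta> \<in> F" "tr \<xi> = tr \<zeta>" for \<xi> \<zeta>
      using e[of \<xi> \<zeta>] eE[of \<xi> \<zeta>] that unfolding tr_def prod.inject by blast
    define S where "S = tr ` {\<xi>\<in>F. s \<xi>}"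
    have "(E, S, i) \<in> ?M"
      using E F unfolding S_def tr_def Fpow_def by auto
    then obtain y where y: "y \<in> X" "h y = (E, S, i)" using h by (metis imageE)
    have "y \<in> f \<xi> \<longleftrightarrow> s \<xi>" if "\<xi> \<in> F" for \<xi>
    proof -
      have "y \<in> f \<xi> \<longleftrightarrow> tr \<xi> \<in> S" unfolding f_def tr_def using y by (cases \<xi>) auto
      also have "\<dots> \<longleftrightarrow> s \<xi>" unfolding S_def using inj that by blast
      finally show ?thesis .
    qed
    then show "\<exists>y\<in>D i. \<forall>\<xi>\<in>F. y \<in> f \<xi> \<longleftrightarrow> s \<xi>" using y unfolding D_def by auto
  qed
  ultimately show ?thesis using that by blast
qed

text \<open>Zorn's lemma is applied to the set \<open>H\<close> of indices at which \<open>f\<close>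
  has been altered. Independence passes to unions of chains because it concerns finitely many
  indices at a time, and those altered by the union are already altered by one chain member.\<close>

lemma ex_saturated_independent:
  fixes f :: "'a set \<times> 'a set \<Rightarrow> 'a set"
  assumes "independent_on L J D f"
  shows "\<exists>g. independent_on L J D g \<and>
    (\<forall>P Q. P \<subseteq> Q \<and> independent_on L J D (g((P, Q) := g (P, Q) - Q \<union> P)) \<longrightarrow>
       g (P, Q) \<inter> Q = P)"
proof -
  define K where "K H \<xi> = (if \<xi> \<in> H then f \<xi> - snd \<xi> \<union> fst \<xi> else f \<xi>)" for H \<xi>
  let ?A = "{H. independent_on L J D (K H)}"
  have "\<exists>M\<in>?A. \<forall>H\<in>?A. M \<subseteq> H \<longrightarrow> H = M"
  proof (rule subset_Zorn_nonempty)
    have "K {} = f" unfolding K_def by auto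
    then show "?A \<noteq> {}" using assms by (metis empty_Collect_eq)
    fix \<C> assume C: "\<C> \<noteq> {}" "subset.chain ?A \<C>"
    have "\<exists>y\<in>D j. \<forall>\<xi>\<in>F. y \<in> K (\<Union>\<C>) \<xi> \<longleftrightarrow> s \<xi>" if F: "finite F" "F \<subseteq> L" "j \<in> J" for F s j
    proof -
      have "finite (F \<inter> \<Union>\<C>)" "F \<inter> \<Union>\<C> \<subseteq> \<Union>\<C>" using F by auto
      then obtain H where H: "H \<in> \<C>" "F \<inter> \<Union>\<C> \<subseteq> H"
        using finite_subset_Union_chain[of "F \<inter> \<Union>\<C>" \<C>] C by metis
      then have "independent_on L J D (K H)" using C(2) unfolding subset.chain_def by blast
      then obtain y where "y \<in> D j" "\<forall>\<xi>\<in>F. y \<in> K H \<xi> \<longleftrightarrow> s \<xi>"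
        using F unfolding independent_on_def by metis
      moreover have "K H \<xi> = K (\<Union>\<C>) \<xi>" if "\<xi> \<in> F" for \<xi> using H that unfolding K_def by auto
      ultimately show ?thesis by auto
    qed
    then show "\<Union>\<C> \<in> ?A" unfolding independent_on_def by blast
  qed
  then obtain M where M: "independent_on L J D (K M)"
    and max: "\<And>H. \<lbrakk>independent_on L J D (K H); M \<subseteq> H\<rbrakk> \<Longrightarrow> H = M" by blast
  have "K M (P, Q) \<inter> Q = P"
    if PQ: "P \<subseteq> Q" and ind: "independent_on L J D ((K M)((P, Q) := K M (P, Q) - Q \<union> P))" for P Q
  proof -
    \<comment> \<open>Altering twice at one index changes nothing more since
      \<open>P \<subseteq> Q\<close>, so this also holds if \<open>(P, Q)\<close> is already in
      \<open>M\<close>.\<close>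
    have "(K M)((P, Q) := K M (P, Q) - Q \<union> P) = K (insert (P, Q) M)"
      using PQ by (auto simp: K_def fun_eq_iff)
    then have "(P, Q) \<in> M" using max ind by (metis insertI1 subset_insertI)
    then show ?thesis using PQ unfolding K_def by auto
  qed
  then show ?thesis using M by blast
qed

section \<open>The topology of a saturated independent family\<close>

text \<open>This is the initial topology for the map of \<open>X\<close> into a power of the
  two-point discrete space, indexed by \<open>L\<close>, with coordinates given by membership in
  \<open>g \<xi>\<close>. Its basic neighbourhoods fix finitely many coordinates.\<close>

definition cell_topology :: "'a set \<Rightarrow> 'i set \<Rightarrow> ('i \<Rightarrow> 'a set) \<Rightarrow> 'a topology" where
  "cell_topology X L g = topology (\<lambda>U. U \<subseteq> X \<and>
     (\<forall>x\<in>U. \<exists>F. finite F \<and> F \<subseteq> L \<and> {y\<in>X. \<forall>\<xi>\<in>F. y \<in> g \<xi> \<longleftrightarrow> x \<in> g \<xi>} \<subseteq> U))"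

lemma openin_cell_topology:
  "openin (cell_topology X L g) U \<longleftrightarrow> U \<subseteq> X \<and>
     (\<forall>x\<in>U. \<exists>F. finite F \<and> F \<subseteq> L \<and> {y\<in>X. \<forall>\<xi>\<in>F. y \<in> g \<xi> \<longleftrightarrow> x \<in> g \<xi>} \<subseteq> U)"
proof -
  define P where "P U \<longleftrightarrow> U \<subseteq> X \<and>
    (\<forall>x\<in>U. \<exists>F. finite F \<and> F \<subseteq> L \<and> {y\<in>X. \<forall>\<xi>\<in>F. y \<in> g \<xi> \<longleftrightarrow> x \<in> g \<xi>} \<subseteq> U)" for U
  have "istopology P"
    unfolding istopology_def
  proof (intro conjI allI impI)
    fix S T assume S: "P S" and T: "P T"
    show "P (S \<inter> T)"
      unfolding P_def
    proof (intro conjI ballI)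
      show "S \<inter> T \<subseteq> X" using S unfolding P_def by blast
      fix x assume x: "x \<in> S \<inter> T"
      obtain F where F: "finite F" "F \<subseteq> L" "{y\<in>X. \<forall>\<xi>\<in>F. y \<in> g \<xi> \<longleftrightarrow> x \<in> g \<xi>} \<subseteq> S"
        using S x unfolding P_def by blast
      obtain G where G: "finite G" "G \<subseteq> L" "{y\<in>X. \<forall>\<xi>\<in>G. y \<in> g \<xi> \<longleftrightarrow> x \<in> g \<xi>} \<subseteq> T"
        using T x unfolding P_def by blast
      have "{y\<in>X. \<forall>\<xi>\<in>F \<union> G. y \<in> g \<xi> \<longleftrightarrow> x \<in> g \<xi>} \<subseteq> S \<inter> T"
        using F(3) G(3) by auto
      then show "\<exists>F. finite F \<and> F \<subseteq> L \<and> {y\<in>X. \<forall>\<xi>\<in>F. y \<in> g \<xi> \<longleftrightarrow> x \<in> g \<xi>} \<subseteq> S \<inter> T"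
        using F(1,2) G(1,2) by (intro exI[of _ "F \<union> G"]) simp
    qed
  next
    fix \<K> assume K: "\<forall>K\<in>\<K>. P K"
    show "P (\<Union>\<K>)"
      unfolding P_def
    proof (intro conjI ballI)
      show "\<Union>\<K> \<subseteq> X" using K unfolding P_def by blast
      fix x assume "x \<in> \<Union>\<K>"
      then obtain S where S: "S \<in> \<K>" "x \<in> S" by blast
      then obtain F where "finite F" "F \<subseteq> L" "{y\<in>X. \<forall>\<xi>\<in>F. y \<in> g \<xi> \<longleftrightarrow> x \<in> g \<xi>} \<subseteq> S"
        using bspec[OF K S(1)] unfolding P_def by blast
      then show "\<exists>F. finite F \<and> F \<subseteq> L \<and> {y\<in>X. \<forall>\<xi>\<in>F. y \<in> g \<xi> \<longleftrightarrow> x \<in> g \<xi>} \<subseteq> \<Union>\<K>"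
        using S(1) by (intro exI[of _ F]) auto
    qed
  qed
  moreover have "cell_topology X L g = topology P" unfolding cell_topology_def P_def ..
  ultimately show ?thesis by (simp add: P_def)
qed

lemma topspace_cell_topology [simp]: "topspace (cell_topology X L g) = X"
proof
  show "topspace (cell_topology X L g) \<subseteq> X"
    using openin_topspace[of "cell_topology X L g"] unfolding openin_cell_topology by blast
  have "openin (cell_topology X L g) X"
    unfolding openin_cell_topology by (intro conjI ballI exI[of _ "{}"]) auto
  then show "X \<subseteq> topspace (cell_topology X L g)" by (rule openin_subset)
qed

lemma openin_cell:
  assumes "finite F" "F \<subseteq> L"
  shows "openin (cell_topology X L g) {y\<in>X. \<forall>\<xi>\<in>F. y \<in> g \<xi> \<longleftrightarrow> s \<xi>}"
  unfolding openin_cell_topology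
proof (intro conjI ballI)
  fix x assume "x \<in> {y\<in>X. \<forall>\<xi>\<in>F. y \<in> g \<xi> \<longleftrightarrow> s \<xi>}"
  then have "{y\<in>X. \<forall>\<xi>\<in>F. y \<in> g \<xi> \<longleftrightarrow> x \<in> g \<xi>} \<subseteq> {y\<in>X. \<forall>\<xi>\<in>F. y \<in> g \<xi> \<longleftrightarrow> s \<xi>}"
    by auto
  then show "\<exists>F'. finite F' \<and> F' \<subseteq> L \<and>
      {y\<in>X. \<forall>\<xi>\<in>F'. y \<in> g \<xi> \<longleftrightarrow> x \<in> g \<xi>} \<subseteq> {y\<in>X. \<forall>\<xi>\<in>F. y \<in> g \<xi> \<longleftrightarrow> s \<xi>}"
    using assms by blast
qed auto

lemma completely_regular_cell_topology: "completely_regular_space (cell_topology X L g)"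
  unfolding completely_regular_space_def
proof (intro allI impI)
  fix S x assume S: "closedin (cell_topology X L g) S \<and> x \<in> topspace (cell_topology X L g) - S"
  then have "openin (cell_topology X L g) (X - S)" "x \<in> X - S"
    unfolding closedin_def by auto
  then obtain F where F: "finite F" "F \<subseteq> L" "{y\<in>X. \<forall>\<xi>\<in>F. y \<in> g \<xi> \<longleftrightarrow> x \<in> g \<xi>} \<subseteq> X - S"
    unfolding openin_cell_topology by blast
  \<comment> \<open>The indicator of the complement of a cell depends only on the coordinates in
    \<open>F\<close>, so all its preimages are open.\<close>
  define f :: "'a \<Rightarrow> real" where "f y = (if \<forall>\<xi>\<in>F. y \<in> g \<xi> \<longleftrightarrow> x \<in> g \<xi> then 0 else 1)" for y
  have f: "f z = f y" if "\<forall>\<xi>\<in>F. z \<in> g \<xi> \<longleftrightarrow> y \<in> g \<xi>" for z y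
    using that unfolding f_def by auto
  have "openin (cell_topology X L g) {y\<in>X. f y \<in> U}" for U
    unfolding openin_cell_topology
  proof (intro conjI ballI)
    fix y assume "y \<in> {y\<in>X. f y \<in> U}"
    then have "z \<in> {y\<in>X. f y \<in> U}" if "z \<in> {z\<in>X. \<forall>\<xi>\<in>F. z \<in> g \<xi> \<longleftrightarrow> y \<in> g \<xi>}" for z
      using that f[of z y] by auto
    then have "{z\<in>X. \<forall>\<xi>\<in>F. z \<in> g \<xi> \<longleftrightarrow> y \<in> g \<xi>} \<subseteq> {y\<in>X. f y \<in> U}"
      by blast
    then show "\<exists>F. finite F \<and> F \<subseteq> L \<and> {z\<in>X. \<forall>\<xi>\<in>F. z \<in> g \<xi> \<longleftrightarrow> y \<in> g \<xi>} \<subseteq> {y\<in>X. f y \<in> U}"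
      using F(1,2) by blast
  qed auto
  then have "continuous_map (cell_topology X L g) (top_of_set {0..1}) f"
    unfolding continuous_map_def by (auto simp: f_def)
  moreover have "f x = 0" unfolding f_def by simp
  moreover have "f ` S \<subseteq> {1}"
    using F(3) S closedin_subset[of "cell_topology X L g" S] unfolding f_def by fastforce
  ultimately show "\<exists>f. continuous_map (cell_topology X L g) (top_of_set {0..1::real}) f \<and> f x = 0 \<and> f ` S \<subseteq> {1}"
    by blast
qed

section \<open>Consequences of saturation\<close>

locale saturated_independent =
  fixes X :: "'a set" and J :: "'j set" and D :: "'j \<Rightarrow> 'a set"
    and g :: "'a set \<times> 'a set \<Rightarrow> 'a set"
  assumes infinite_X: "infinite X"
    and cover: "X = (\<Union>j\<in>J. D j)"
    and disj: "disjoint_family_on D J"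
    and indep: "independent_on (traces X) J D g"
    and saturated: "\<And>P Q. \<lbrakk>P \<subseteq> Q; independent_on (traces X) J D (g((P, Q) := g (P, Q) - Q \<union> P))\<rbrakk>
       \<Longrightarrow> g (P, Q) \<inter> Q = P"
begin

lemma ex_point:
  assumes "finite F" "F \<subseteq> traces X" "j \<in> J"
  shows "\<exists>y\<in>D j. \<forall>\<xi>\<in>F. y \<in> g \<xi> \<longleftrightarrow> s \<xi>"
  using indep assms unfolding independent_on_def by blast

lemma infinite_traces: "infinite (traces X)"
proof -
  have "(\<lambda>x. ({x}, {x})) ` X \<subseteq> traces X" by (auto simp: traces_def)
  moreover have "infinite ((\<lambda>x. ({x}, {x})) ` X)"
    using infinite_X by (subst finite_image_iff) (auto simp: inj_on_def)
  ultimately show ?thesis using finite_subset by blast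
qed

text \<open>Hypothesis \<open>nd\<close> says that \<open>A\<close> is nowhere dense: every finite
  condition extends to one that no point of \<open>A\<close> satisfies. Witnesses can then be chosen
  off \<open>A\<close>, where altering \<open>g (P, A)\<close> has no effect, so saturation
  applies.\<close>

lemma trace_of_nowhere_dense:
  assumes nd: "\<And>F s. \<lbrakk>finite F; F \<subseteq> traces X\<rbrakk> \<Longrightarrow> \<exists>F' s'. finite F' \<and> F' \<subseteq> traces X \<and> F \<subseteq> F' \<and>
       (\<forall>\<xi>\<in>F. s' \<xi> = s \<xi>) \<and> (\<forall>a\<in>A. \<exists>\<xi>\<in>F'. (a \<in> g \<xi>) \<noteq> s' \<xi>)"
    and P: "P \<subseteq> A"
  shows "g (P, A) \<inter> A = P"
proof (rule saturated[OF P])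
  show "independent_on (traces X) J D (g((P, A) := g (P, A) - A \<union> P))"
    unfolding independent_on_def
  proof (intro allI impI)
    fix F s j assume F: "finite F \<and> F \<subseteq> traces X \<and> j \<in> J"
    then obtain F' s' where F': "finite F'" "F' \<subseteq> traces X" "F \<subseteq> F'"
       "\<forall>\<xi>\<in>F. s' \<xi> = s \<xi>" "\<forall>a\<in>A. \<exists>\<xi>\<in>F'. (a \<in> g \<xi>) \<noteq> s' \<xi>"
      using nd[of F s] by blast
    obtain y where y: "y \<in> D j" "\<forall>\<xi>\<in>F'. y \<in> g \<xi> \<longleftrightarrow> s' \<xi>"
      using ex_point[OF F'(1,2), of j s'] F by blast
    have "y \<notin> A" using y(2) F'(5) by blast
    then show "\<exists>y\<in>D j. \<forall>\<xi>\<in>F. y \<in> (g((P, A) := g (P, A) - A \<union> P)) \<xi> \<longleftrightarrow> s \<xi>"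
      using y F'(3,4) P by (intro bexI[of _ y]) auto
  qed
qed

lemma separated:
  assumes "x \<in> X" "y \<in> X" "x \<noteq> y"
  obtains \<xi> where "\<xi> \<in> traces X" "x \<in> g \<xi>" "y \<notin> g \<xi>"
proof -
  have "g ({x}, {x,y}) \<inter> {x,y} = {x}"
  proof (rule trace_of_nowhere_dense)
    fix F :: "('a set \<times> 'a set) set" and s assume F: "finite F" "F \<subseteq> traces X"
    \<comment> \<open>Two fresh indices show that a two-point set is nowhere dense: the value
      prescribed at \<open>\<zeta>\<close> excludes \<open>x\<close>, and the one at
      \<open>\<eta>\<close> excludes \<open>y\<close>.\<close>
    obtain \<zeta> where \<zeta>: "\<zeta> \<in> traces X" "\<zeta> \<notin> F"
      using infinite_traces F(1) by (meson finite_subset subsetI)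
    obtain \<eta> where \<eta>: "\<eta> \<in> traces X" "\<eta> \<notin> insert \<zeta> F"
      using infinite_traces F(1) by (meson finite_insert finite_subset subsetI)
    show "\<exists>F' s'. finite F' \<and> F' \<subseteq> traces X \<and> F \<subseteq> F' \<and>
       (\<forall>\<xi>\<in>F. s' \<xi> = s \<xi>) \<and> (\<forall>a\<in>{x,y}. \<exists>\<xi>\<in>F'. (a \<in> g \<xi>) \<noteq> s' \<xi>)"
      using F \<zeta> \<eta>
      by (intro exI[of _ "insert \<eta> (insert \<zeta> F)"] exI[of _ "s(\<zeta> := x \<notin> g \<zeta>, \<eta> := y \<notin> g \<eta>)"]) auto
  qed auto
  then show ?thesis using assms by (intro that[of "({x}, {x,y})"]) (auto simp: traces_def)
qed

lemma D_subset: "j \<in> J \<Longrightarrow> D j \<subseteq> X"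
  using cover by blast

text \<open>Hypothesis \<open>sd\<close> says that \<open>A\<close> is dense in the cell of
  \<open>F\<close> and \<open>s\<close>. If \<open>A\<close> contained no trace of a cell, its
  complement in \<open>D i\<close> would be dense there too, and saturation would let
  \<open>g (P, Q)\<close> split that cell into two dense parts, although \<open>g (P, Q)\<close> is
  clopen.\<close>

lemma somewhere_dense_contains_cell:
  assumes i: "i \<in> J" and A: "A \<subseteq> D i" and F: "finite F" "F \<subseteq> traces X"
    and sd: "\<And>F' s'. \<lbrakk>finite F'; F' \<subseteq> traces X; F \<subseteq> F'; \<forall>\<xi>\<in>F. s' \<xi> = s \<xi>\<rbrakk>
        \<Longrightarrow> \<exists>a\<in>A. \<forall>\<xi>\<in>F'. a \<in> g \<xi> \<longleftrightarrow> s' \<xi>"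
  shows "\<exists>F' s'. finite F' \<and> F' \<subseteq> traces X \<and> {y\<in>D i. \<forall>\<xi>\<in>F'. y \<in> g \<xi> \<longleftrightarrow> s' \<xi>} \<subseteq> A"
proof (rule ccontr)
  assume contr: "\<not> ?thesis"
  have out: "\<exists>y\<in>D i - A. \<forall>\<xi>\<in>F'. y \<in> g \<xi> \<longleftrightarrow> s' \<xi>" if "finite F'" "F' \<subseteq> traces X" for F' s'
    using contr that by blast
  \<comment> \<open>\<open>A\<close> is dense and codense in \<open>Q\<close>, so redefining \<open>g (P, Q)\<close> on \<open>Q\<close> keeps independence. The
    condition \<open>F\<close> may itself involve the index \<open>(P, Q)\<close>.\<close>
  define Q where "Q = {y\<in>D i. \<forall>\<xi>\<in>F. y \<in> g \<xi> \<longleftrightarrow> s \<xi>}"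
  define P where "P = A \<inter> Q"
  define h where "h = g((P, Q) := g (P, Q) - Q \<union> P)"
  have PQ: "(P, Q) \<in> traces X"
    using D_subset[OF i] unfolding traces_def P_def Q_def by auto
  have "independent_on (traces X) J D h"
    unfolding independent_on_def
  proof (intro allI impI)
    fix F1 s1 j assume F1: "finite F1 \<and> F1 \<subseteq> traces X \<and> j \<in> J"
    have unaffected: "\<exists>y\<in>D j. \<forall>\<xi>\<in>F1. y \<in> h \<xi> \<longleftrightarrow> s1 \<xi>"
      if "y \<in> D j" "y \<notin> Q" "\<forall>\<xi>\<in>F1. y \<in> g \<xi> \<longleftrightarrow> s1 \<xi>" for y
    proof -
      have "\<forall>\<xi>\<in>F1. y \<in> h \<xi> \<longleftrightarrow> s1 \<xi>" using that unfolding h_def P_def by auto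
      then show ?thesis using that(1) by blast
    qed
    show "\<exists>y\<in>D j. \<forall>\<xi>\<in>F1. y \<in> h \<xi> \<longleftrightarrow> s1 \<xi>"
    \<comment> \<open>If the pieces differ, or \<open>s1\<close> contradicts \<open>s\<close> at an
      index other than \<open>(P, Q)\<close>, every old witness lies outside \<open>Q\<close>. The
      index \<open>(P, Q)\<close> is exempt because on \<open>Q\<close> the new set is
      \<open>P\<close>, whatever \<open>s\<close> demands.\<close>
    proof (cases "j = i \<and> (\<forall>\<xi>\<in>F1 \<inter> F - {(P, Q)}. s1 \<xi> = s \<xi>)")
      case True
      \<comment> \<open>The condition \<open>F\<close> stays complete, including a possible
        \<open>(P, Q)\<close>, to force the witness into \<open>Q\<close>. The new demand at
        \<open>(P, Q)\<close> is met by choosing the witness inside or outside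
        \<open>A\<close>.\<close>
      define F2 where "F2 = F \<union> (F1 - {(P, Q)})"
      define s2 where "s2 \<xi> = (if \<xi> \<in> F then s \<xi> else s1 \<xi>)" for \<xi>
      have F2: "finite F2" "F2 \<subseteq> traces X" "F \<subseteq> F2" "\<forall>\<xi>\<in>F. s2 \<xi> = s \<xi>"
        using F F1 unfolding F2_def s2_def by auto
      have s21: "s2 \<xi> = s1 \<xi>" if "\<xi> \<in> F1" "\<xi> \<noteq> (P, Q)" for \<xi>
        using True that unfolding s2_def by auto
      have "\<exists>y\<in>D i. (\<forall>\<xi>\<in>F2. y \<in> g \<xi> \<longleftrightarrow> s2 \<xi>) \<and> (y \<in> A \<longleftrightarrow> s1 (P, Q))"
      proof (cases "s1 (P, Q)")
        case True
        then show ?thesis using sd[OF F2] A by blast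
      next
        case False
        then show ?thesis using out[OF F2(1,2)] by blast
      qed
      then obtain y where y: "y \<in> D i" "\<forall>\<xi>\<in>F2. y \<in> g \<xi> \<longleftrightarrow> s2 \<xi>" "y \<in> A \<longleftrightarrow> s1 (P, Q)" by blast
      have "y \<in> Q" using y F2(3,4) unfolding Q_def by blast
      then have "y \<in> h (P, Q) \<longleftrightarrow> s1 (P, Q)" using y(3) unfolding h_def P_def by auto
      moreover have "y \<in> h \<xi> \<longleftrightarrow> s1 \<xi>" if "\<xi> \<in> F1" "\<xi> \<noteq> (P, Q)" for \<xi>
        using y(2) that s21[OF that] unfolding h_def F2_def by auto
      ultimately show ?thesis using y(1) True by blast
    next
      case False
      obtain y where y: "y \<in> D j" "\<forall>\<xi>\<in>F1. y \<in> g \<xi> \<longleftrightarrow> s1 \<xi>"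
        using ex_point[of F1 j s1] F1 by blast
      have "y \<notin> Q"
      proof (cases "j = i")
        case True
        then show ?thesis using False y(2) unfolding Q_def by blast
      next
        case False
        then have "D j \<inter> D i = {}" using disj F1 i unfolding disjoint_family_on_def by blast
        then show ?thesis using y(1) unfolding Q_def by blast
      qed
      then show ?thesis using unaffected y by blast
    qed
  qed
  then have gQ: "g (P, Q) \<inter> Q = P"
    using saturated[of P Q] unfolding h_def P_def by blast
  \<comment> \<open>If \<open>(P, Q)\<close> is not in \<open>F\<close>, demanding nonmembership in
    \<open>g (P, Q)\<close> contradicts density of \<open>A\<close>. Hence \<open>F\<close> already
    demands membership, which contradicts density of the complement of \<open>A\<close>.\<close>
  define s' where "s' = (if (P, Q) \<in> F then s else s((P, Q) := False))"
  have ins: "finite (insert (P, Q) F)" "insert (P, Q) F \<subseteq> traces X" "\<forall>\<xi>\<in>F. s' \<xi> = s \<xi>"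
    using F PQ unfolding s'_def by auto
  obtain a where a: "a \<in> A" "\<forall>\<xi>\<in>insert (P, Q) F. a \<in> g \<xi> \<longleftrightarrow> s' \<xi>"
    using sd[OF ins(1,2) _ ins(3)] by blast
  have "a \<in> P" using a ins(3) A unfolding P_def Q_def by blast
  then have "s' (P, Q)" using gQ a(2) by blast
  then have sPQ: "(P, Q) \<in> F" "s (P, Q)" unfolding s'_def by (auto split: if_splits)
  obtain y where y: "y \<in> D i - A" "\<forall>\<xi>\<in>F. y \<in> g \<xi> \<longleftrightarrow> s \<xi>" using out[OF F] by blast
  then have "y \<in> g (P, Q) \<inter> Q" using sPQ unfolding Q_def by blast
  then show False using gQ y(1) unfolding P_def by blast
qed

abbreviation "T \<equiv> cell_topology X (traces X) g"

lemma Hausdorff_T: "Hausdorff_space T"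
  unfolding Hausdorff_space_def
proof (intro allI impI)
  fix x y assume "x \<in> topspace T \<and> y \<in> topspace T \<and> x \<noteq> y"
  then have xy: "x \<in> X" "y \<in> X" "x \<noteq> y" by auto
  from separated[OF this] obtain \<xi> where \<xi>: "\<xi> \<in> traces X" "x \<in> g \<xi>" "y \<notin> g \<xi>" .
  have "openin T {z\<in>X. \<forall>\<zeta>\<in>{\<xi>}. z \<in> g \<zeta> \<longleftrightarrow> b}" for b
    using \<xi>(1) by (intro openin_cell) auto
  from this[of True] this[of False] show "\<exists>U V. openin T U \<and> openin T V \<and> x \<in> U \<and> y \<in> V \<and> disjnt U V"
    using xy \<xi> by (intro exI[of _ "{z\<in>X. z \<in> g \<xi>}"] exI[of _ "{z\<in>X. z \<notin> g \<xi>}"]) (auto simp: disjnt_def)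
qed

lemma dense_D:
  assumes "j \<in> J"
  shows "T closure_of D j = topspace T"
  unfolding dense_intersects_open
proof (intro allI impI)
  fix U assume U: "openin T U \<and> U \<noteq> {}"
  then obtain x F where F: "finite F" "F \<subseteq> traces X" "{y\<in>X. \<forall>\<xi>\<in>F. y \<in> g \<xi> \<longleftrightarrow> x \<in> g \<xi>} \<subseteq> U"
    unfolding openin_cell_topology by blast
  from ex_point[OF F(1,2) assms, of "\<lambda>\<xi>. x \<in> g \<xi>"] obtain y where "y \<in> D j" "\<forall>\<xi>\<in>F. y \<in> g \<xi> \<longleftrightarrow> x \<in> g \<xi>"
    by blast
  then show "D j \<inter> U \<noteq> {}" using F(3) D_subset[OF assms] by blast
qed

text \<open>If \<open>A\<close> were nowhere dense, the clopen set \<open>g ({a}, A)\<close> would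
  isolate \<open>a\<close> in \<open>A\<close>. So \<open>A\<close> is dense in some cell and
  contains a cell trace by \<open>somewhere_dense_contains_cell\<close>.\<close>

lemma crowded_contains_open_trace:
  assumes i: "i \<in> J" and A: "A \<subseteq> D i" "A \<noteq> {}" "A \<subseteq> T derived_set_of A"
  shows "\<exists>G. openin T G \<and> G \<inter> D i \<noteq> {} \<and> G \<inter> D i \<subseteq> A"
proof -
  define sd where "sd F s \<longleftrightarrow>
      (\<forall>F' s'. finite F' \<and> F' \<subseteq> traces X \<and> F \<subseteq> F' \<and> (\<forall>\<xi>\<in>F. s' \<xi> = s \<xi>) \<longrightarrow>
         (\<exists>a\<in>A. \<forall>\<xi>\<in>F'. a \<in> g \<xi> \<longleftrightarrow> s' \<xi>))" for F and s :: "'a set \<times> 'a set \<Rightarrow> bool"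
  have "\<exists>F s. finite F \<and> F \<subseteq> traces X \<and> sd F s"
  proof (rule ccontr)
    assume contr: "\<not> ?thesis"
    obtain a where a: "a \<in> A" using A(2) by blast
    have ga: "g ({a}, A) \<inter> A = {a}"
    proof (rule trace_of_nowhere_dense)
      fix F :: "('a set \<times> 'a set) set" and s assume F: "finite F" "F \<subseteq> traces X"
      have "\<not> sd F s" using contr F by blast
      then obtain F' s' where F': "finite F'" "F' \<subseteq> traces X" "F \<subseteq> F'" "\<forall>\<xi>\<in>F. s' \<xi> = s \<xi>"
        and no: "\<not> (\<exists>a\<in>A. \<forall>\<xi>\<in>F'. a \<in> g \<xi> \<longleftrightarrow> s' \<xi>)"
        unfolding sd_def by blast
      from no have "\<forall>a\<in>A. \<exists>\<xi>\<in>F'. (a \<in> g \<xi>) \<noteq> s' \<xi>" by blast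
      with F' show "\<exists>F' s'. finite F' \<and> F' \<subseteq> traces X \<and> F \<subseteq> F' \<and>
         (\<forall>\<xi>\<in>F. s' \<xi> = s \<xi>) \<and> (\<forall>a\<in>A. \<exists>\<xi>\<in>F'. (a \<in> g \<xi>) \<noteq> s' \<xi>)"
        by (intro exI[of _ F'] exI[of _ s'] conjI)
    qed (use a in auto)
    have aX: "a \<in> X" and "({a}, A) \<in> traces X"
      using a A(1) D_subset[OF i] unfolding traces_def by auto
    have "openin T {z\<in>X. \<forall>\<zeta>\<in>{({a}, A)}. z \<in> g \<zeta> \<longleftrightarrow> True}"
      by (rule openin_cell) (use \<open>({a}, A) \<in> traces X\<close> in auto)
    then have o: "openin T {z\<in>X. z \<in> g ({a}, A)}" by simp
    have "a \<in> T derived_set_of A" using a A(3) by blast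
    then have "a \<in> N \<Longrightarrow> openin T N \<Longrightarrow> \<exists>y\<noteq>a. y \<in> A \<and> y \<in> N" for N
      unfolding in_derived_set_of by blast
    from this[OF _ o] have "\<exists>y\<noteq>a. y \<in> A \<and> y \<in> {z\<in>X. z \<in> g ({a}, A)}"
      using aX ga by blast
    then show False using ga by blast
  qed
  then obtain F s where F: "finite F" "F \<subseteq> traces X" and sd: "sd F s" by blast
  have "\<exists>F' s'. finite F' \<and> F' \<subseteq> traces X \<and> {y\<in>D i. \<forall>\<xi>\<in>F'. y \<in> g \<xi> \<longleftrightarrow> s' \<xi>} \<subseteq> A"
    by (rule somewhere_dense_contains_cell[where s = s, OF i A(1) F]) (use sd in \<open>simp add: sd_def\<close>)
  then obtain F' s' where F':
    "finite F'" "F' \<subseteq> traces X" "{y\<in>D i. \<forall>\<xi>\<in>F'. y \<in> g \<xi> \<longleftrightarrow> s' \<xi>} \<subseteq> A" by blast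
  define G where "G = {y\<in>X. \<forall>\<xi>\<in>F'. y \<in> g \<xi> \<longleftrightarrow> s' \<xi>}"
  have "openin T G" unfolding G_def by (rule openin_cell[OF F'(1,2)])
  moreover have "G \<inter> D i \<noteq> {}"
    using ex_point[OF F'(1,2) i, of s'] D_subset[OF i] unfolding G_def by blast
  moreover have "G \<inter> D i \<subseteq> A" using F'(3) unfolding G_def by blast
  ultimately show ?thesis by blast
qed

end

section \<open>Construction of the space\<close>

theorem theorem3p7:
  fixes n :: nat and \<kappa> :: "'a rel"
  assumes "1 < n"
    and "Card_order \<kappa>" and "natLeq \<le>o \<kappa>"
  shows "\<exists>T :: 'a topology.
           n_resolvable n T \<and> tychonoff_space T \<and> |topspace T| =o \<kappa> \<and>
           \<not> (\<exists>U. expansion U T \<and> exactly_n_resolvable n U \<and> quasi_regular_space U)"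
proof -
  define X where "X = Field \<kappa>"
  have X: "|X| =o \<kappa>" unfolding X_def using assms(2) by (rule card_of_Field_ordIso)
  have "infinite X"
    using assms(3) ordIso_symmetric[OF X] infinite_iff_natLeq_ordLeq ordLeq_ordIso_trans by blast
  obtain D f where D: "X = (\<Union>i\<le>n. D i)" "disjoint_family_on D {..n}"
    and f: "independent_on (traces X) {..n} D f"
    using ex_independent_on_traces[OF \<open>infinite X\<close>] .
  obtain g where g: "independent_on (traces X) {..n} D g"
    and saturated: "\<forall>P Q. P \<subseteq> Q \<and>
      independent_on (traces X) {..n} D (g((P, Q) := g (P, Q) - Q \<union> P)) \<longrightarrow> g (P, Q) \<inter> Q = P"
    using ex_saturated_independent[OF f] by (elim exE conjE)
  interpret saturated_independent X "{..n}" D g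
    by (rule saturated_independent.intro[OF \<open>infinite X\<close> D g]) (use saturated in blast)
  have ne: "X \<noteq> {}" using \<open>infinite X\<close> by auto
  have "n_resolvable n T"
  proof -
    have Dne: "D i \<noteq> {}" if "i \<le> n" for i
      using dense_D[of i] that ne by auto
    \<comment> \<open>There are \<open>n + 1\<close> dense pieces; the first \<open>n\<close> serve
      as the witness here.\<close>
    have "inj_on D {..<n}"
      using Dne D(2) unfolding inj_on_def disjoint_family_on_def
      by (metis Int_absorb atMost_iff lessThan_iff less_imp_le)
    moreover have "pairwise disjnt (D ` {..<n})"
      by (intro disjoint_family_on_disjoint_image disjoint_family_on_mono[OF _ D(2)]) auto
    ultimately show ?thesis
      unfolding n_resolvable_def using Dne dense_D D_subset
      by (intro exI[of _ "D ` {..<n}"]) (simp add: card_image)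
  qed
  moreover have "tychonoff_space T"
    unfolding tychonoff_space_def using completely_regular_cell_topology Hausdorff_T by blast
  moreover have "|topspace T| =o \<kappa>" using X by simp
  moreover have "\<not> exactly_n_resolvable n U" if "expansion U T" "quasi_regular_space U" for U
  proof (rule no_exactly_n_resolvable_expansion[OF assms(1) _ _ D(2) _ _ _ that])
    show "t1_space T" by (rule Hausdorff_imp_t1_space[OF Hausdorff_T])
    show "topspace T = (\<Union>i\<le>n. D i)" using D(1) by simp
    show "T closure_of D i = topspace T" if "i \<le> n" for i using dense_D that by simp
    show "topspace T \<noteq> {}" using ne by simp
    show "\<exists>G. openin T G \<and> G \<inter> D i \<noteq> {} \<and> G \<inter> D i \<subseteq> A"
      if "i \<le> n" "A \<subseteq> D i" "A \<noteq> {}" "A \<subseteq> T derived_set_of A" for i A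
      using crowded_contains_open_trace that by simp
  qed
  ultimately show ?thesis by blast
qed

end
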